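(* Assume that a random dynamical system $\Phi$ generates a periodic probability measure $\mu$ of period $\tau$ on the product measurable space $(\Omega\times\mathbb{X},\mathcal F\otimes\mathcal B(\mathbb{X}))$. Then the measure $\hat\mu$ on $(\hat\Omega,\hat{\mathcal F})$ defined by $$\hat\mu(I_\tau\times A)=\frac1\tau\int_0^\tau\mu_s(A)\,ds,\qquad\hat\mu(\emptyset\times A)=0,\qquad A\in\mathcal F\otimes\mathcal B(\mathbb{X}),$$ is a probability measure, the map $\hat\Theta(t):\hat\Omega\to\hat\Omega$ is $\hat\mu$-preserving, and $\hat\Theta(t_1)\hat\Theta(t_2)=\hat\Theta(t_1+t_2)$ for any $t_1,t_2\in\mathbb{R}^+$. If $\Phi$ is extended to a map over the metric dynamical system $(\hat\Omega,\hat{\mathcal F},\hat\mu,(\hat\Theta(t))_{t\in\mathbb{R}^+})$ by $\hat\Phi(t,\hat\omega)=\Phi(t,\omega)$, $t\in\mathbb{R}^+$, then $\hat\Phi$ is a random dynamical system on $\mathbb{X}$ over $\hat\Theta$ and has a random periodic path $\hat Y:\mathbb{R}^+\times\hat\Omega\to\mathbb{X}$ constructed as follows: for any $\hat\omega^*=(s,\omega^*,x^*(\omega^* ))\in\hat\Omega$, $$\hat Y(t,\hat\omega^* ):=\Phi(t+s,\theta(-s)\omega^* )\,x^*(\theta(-s)\omega^* ),\qquad t\in\mathbb{R}^+ .$$ That is, for all $r,t\in\mathbb{R}^+$, $\hat\Phi(r,\hat\Theta(t)\hat\omega^* )\hat Y(t,\hat\omega^* )=\hat Y(r+t,\hat\omega^*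 )$ and $\hat Y(t+\tau,\hat\omega^* )=\hat Y(t,\hat\Theta(\tau)\hat\omega^* )$.
   Context: $\mathbb{X}$ is a Polish space with Borel $\sigma$-algebra $\mathcal B(\mathbb{X})$; $\mathbb{R}^+=[0,\infty)$. $(\Omega,\mathcal F,P,(\theta(t))_{t\in\mathbb{R}})$ is a metric dynamical system ($\theta(t)$ $P$-preserving, measurably invertible, $\theta(-t)=\theta(t)^{-1}$). A random dynamical system (cocycle) is a jointly measurable $\Phi:\mathbb{R}^+\times\Omega\times\mathbb{X}\to\mathbb{X}$ with $\Phi(0,\omega)=\mathrm{id}$ and $\Phi(t+s,\omega)=\Phi(t,\theta(s)\omega)\Phi(s,\omega)$ for all $s,t\in\mathbb{R}^+$, almost all $\omega$. With $\bar\Theta(t)(\omega,x)=(\theta(t)\omega,\Phi(t,\omega)x)$, a family $\mu_s$, $s\in\mathbb{R}$, of probability measures on $\Omega\times\mathbb{X}$ with marginal $P$ on $\Omega$ is a periodic probability measure of period $\tau$ for $\Phi$ if $\mu_{\tau+s}=\mu_s$ and $\bar\Theta(t)\mu_s=\mu_{t+s}$ (push-forward) for all $t\in\mathbb{R}^+$, $s\in\mathbb{R}$. $I_\tau=[0,\tau)$ with addition modulo $\tau$ and $\sigma$-algebra $\mathcal B(I_\tau)=\{\emptyset,I_\tau\}$; $\hat\Omega=I_\tau\times\Omega\times\mathbb{X}$, $\hat{\mathcal F}=\mathcal B(I_\tau)\otimes\mathcal F\otimes\mathcal B(\mathbb{X})$, $\hat\omega=(s,\omega,x)\in\hat\Omega$,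 and $$\hat\Theta(t)\hat\omega=(s+t\ \mathrm{mod}\ \tau,\ \theta(t)\omega,\ \Phi(t,\omega)x),\qquad t\in\mathbb{R}^+.$$ Convention on points in the definition of $\hat Y$: the third coordinate is regarded as the value at $\omega^*$ of a map $x^*:\Omega\to\mathbb{X}$, so that $x^*(\theta(-s)\omega^* )$ makes sense. Accordingly $\hat\Theta(t)$ carries $(s,\omega^*,x^*(\omega^* ))$ to the point with second coordinate $\omega^{**}=\theta(t)\omega^*$ and third coordinate $x^{**}(\omega^{**})$, where $x^{**}(\eta)=\Phi(t,\theta(-t)\eta)x^*(\theta(-t)\eta)$.
   Formalization: As the cocycle law holds only for almost all ω, the semigroup law of Θ̂ and the identities for Ŷ are stated where it holds at ω, resp. at θ(-s)ω* (off a null set for each s); θ is assumed jointly measurable in (t,ω), so that the integral defining μ̂ makes sense. *)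

theory Defs
  imports "HOL-Probability.Probability_Measure" "HOL-Library.Real_Mod"
begin

text \<open>A metric dynamical system over two-sided time. As usual, joint measurability in time and
  \<open>\<omega>\<close> is part of the notion. The group law makes each \<open>\<theta> t\<close> measurably invertible on \<open>space M\<close>,
  with inverse \<open>\<theta> (-t)\<close>.\<close>

definition metric_flow :: "'w measure \<Rightarrow> (real \<Rightarrow> 'w \<Rightarrow> 'w) \<Rightarrow> bool" where
  "metric_flow M \<theta> \<longleftrightarrow>
     prob_space M \<and>
     (\<lambda>(t, \<omega>). \<theta> t \<omega>) \<in> borel \<Otimes>\<^sub>M M \<rightarrow>\<^sub>M M \<and>
     (\<forall>t. distr M M (\<theta> t) = M) \<and>
     (\<forall>\<omega>\<in>space M. \<theta> 0 \<omega> = \<omega> \<and> (\<forall>s t. \<theta> (s + t) \<omega> = \<theta> s (\<theta> t \<omega>)))"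

text \<open>The one-sided counterpart. The semigroup law is required off one null set only, because the
  skew product of a cocycle that holds almost everywhere satisfies it almost everywhere.\<close>

definition metric_semiflow :: "'w measure \<Rightarrow> (real \<Rightarrow> 'w \<Rightarrow> 'w) \<Rightarrow> bool" where
  "metric_semiflow M \<theta> \<longleftrightarrow>
     prob_space M \<and>
     (\<lambda>(t, \<omega>). \<theta> t \<omega>) \<in> restrict_space borel {0..} \<Otimes>\<^sub>M M \<rightarrow>\<^sub>M M \<and>
     (\<forall>t\<ge>0. distr M M (\<theta> t) = M) \<and>
     (AE \<omega> in M. \<theta> 0 \<omega> = \<omega> \<and> (\<forall>s\<ge>0. \<forall>t\<ge>0. \<theta> (s + t) \<omega> = \<theta> s (\<theta> t \<omega>)))"

definition cocycle_at ::
    "(real \<Rightarrow> 'w \<Rightarrow> 'w) \<Rightarrow> (real \<Rightarrow> 'w \<Rightarrow> 'x \<Rightarrow> 'x) \<Rightarrow> 'w \<Rightarrow> bool" where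
  "cocycle_at \<theta> \<Phi> \<omega> \<longleftrightarrow>
     \<Phi> 0 \<omega> = id \<and> (\<forall>s\<ge>0. \<forall>t\<ge>0. \<Phi> (t + s) \<omega> = \<Phi> t (\<theta> s \<omega>) \<circ> \<Phi> s \<omega>)"

definition random_dynamical_system ::
    "'w measure \<Rightarrow> (real \<Rightarrow> 'w \<Rightarrow> 'w) \<Rightarrow> (real \<Rightarrow> 'w \<Rightarrow> 'x::polish_space \<Rightarrow> 'x) \<Rightarrow> bool" where
  "random_dynamical_system M \<theta> \<Phi> \<longleftrightarrow>
     metric_semiflow M \<theta> \<and>
     (\<lambda>(t, \<omega>, x). \<Phi> t \<omega> x) \<in> restrict_space borel {0..} \<Otimes>\<^sub>M (M \<Otimes>\<^sub>M borel) \<rightarrow>\<^sub>M borel \<and>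
     (AE \<omega> in M. cocycle_at \<theta> \<Phi> \<omega>)"

definition skew_product ::
    "(real \<Rightarrow> 'w \<Rightarrow> 'w) \<Rightarrow> (real \<Rightarrow> 'w \<Rightarrow> 'x \<Rightarrow> 'x) \<Rightarrow> real \<Rightarrow> 'w \<times> 'x \<Rightarrow> 'w \<times> 'x" where
  "skew_product \<theta> \<Phi> t = (\<lambda>(\<omega>, x). (\<theta> t \<omega>, \<Phi> t \<omega> x))"

definition periodic_probability_measure ::
    "'w measure \<Rightarrow> (real \<Rightarrow> 'w \<Rightarrow> 'w) \<Rightarrow> (real \<Rightarrow> 'w \<Rightarrow> 'x::polish_space \<Rightarrow> 'x) \<Rightarrow> real \<Rightarrow>
     (real \<Rightarrow> ('w \<times> 'x) measure) \<Rightarrow> bool" where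
  "periodic_probability_measure M \<theta> \<Phi> \<tau> \<mu> \<longleftrightarrow>
     (\<forall>s. prob_space (\<mu> s) \<and> sets (\<mu> s) = sets (M \<Otimes>\<^sub>M borel) \<and> distr (\<mu> s) M fst = M) \<and>
     (\<forall>s. \<mu> (\<tau> + s) = \<mu> s) \<and>
     (\<forall>t\<ge>0. \<forall>s. distr (\<mu> s) (M \<Otimes>\<^sub>M borel) (skew_product \<theta> \<Phi> t) = \<mu> (t + s))"

text \<open>Only the space and the \<open>\<sigma>\<close>-algebra of \<open>hat_space\<close> matter; the circle carries the trivial
  \<open>\<sigma>\<close>-algebra.\<close>

definition hat_space :: "'w measure \<Rightarrow> real \<Rightarrow> (real \<times> 'w \<times> 'x::polish_space) measure" where
  "hat_space M \<tau> = sigma {0..<\<tau>} {{}, {0..<\<tau>}} \<Otimes>\<^sub>M (M \<Otimes>\<^sub>M borel)"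

text \<open>Every measurable \<open>B\<close> is empty or of the form \<open>{0..<\<tau>} \<times> A\<close>, and then \<open>snd ` B = A\<close>.
  \<^const>\<open>measure_of\<close> yields the null measure unless the given set function is a measure.\<close>

definition hat_mu ::
    "'w measure \<Rightarrow> real \<Rightarrow> (real \<Rightarrow> ('w \<times> 'x::polish_space) measure) \<Rightarrow>
     (real \<times> 'w \<times> 'x) measure" where
  "hat_mu M \<tau> \<mu> =
     measure_of (space (hat_space M \<tau>)) (sets (hat_space M \<tau>))
       (\<lambda>B. (\<integral>\<^sup>+ s\<in>{0..<\<tau>}. emeasure (\<mu> s) (snd ` B) \<partial>lborel) / ennreal \<tau>)"

definition hat_Theta ::
    "real \<Rightarrow> (real \<Rightarrow> 'w \<Rightarrow> 'w) \<Rightarrow> (real \<Rightarrow> 'w \<Rightarrow> 'x \<Rightarrow> 'x) \<Rightarrow>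
     real \<Rightarrow> real \<times> 'w \<times> 'x \<Rightarrow> real \<times> 'w \<times> 'x" where
  "hat_Theta \<tau> \<theta> \<Phi> t = (\<lambda>(s, \<omega>, x). ((s + t) rmod \<tau>, \<theta> t \<omega>, \<Phi> t \<omega> x))"

definition hat_Phi ::
    "(real \<Rightarrow> 'w \<Rightarrow> 'x \<Rightarrow> 'x) \<Rightarrow> real \<Rightarrow> real \<times> 'w \<times> 'x \<Rightarrow> 'x \<Rightarrow> 'x" where
  "hat_Phi \<Phi> t = (\<lambda>(s, \<omega>, x). \<Phi> t \<omega>)"

text \<open>A triple \<open>(s, \<omega>, \<xi>)\<close> with a map \<open>\<xi> :: 'w \<Rightarrow> 'x\<close> is a point whose third coordinate is regarded
  as the value of \<open>\<xi>\<close> at \<open>\<omega>\<close>; \<open>hat_point\<close> is the point itself, and \<open>hat_Theta_map\<close> is the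
  action of \<open>hat_Theta\<close> that also transports the map.\<close>

definition hat_point :: "real \<times> 'w \<times> ('w \<Rightarrow> 'x) \<Rightarrow> real \<times> 'w \<times> 'x" where
  "hat_point = (\<lambda>(s, \<omega>, \<xi>). (s, \<omega>, \<xi> \<omega>))"

definition hat_Theta_map ::
    "real \<Rightarrow> (real \<Rightarrow> 'w \<Rightarrow> 'w) \<Rightarrow> (real \<Rightarrow> 'w \<Rightarrow> 'x \<Rightarrow> 'x) \<Rightarrow>
     real \<Rightarrow> real \<times> 'w \<times> ('w \<Rightarrow> 'x) \<Rightarrow> real \<times> 'w \<times> ('w \<Rightarrow> 'x)" where
  "hat_Theta_map \<tau> \<theta> \<Phi> t =
     (\<lambda>(s, \<omega>, \<xi>). ((s + t) rmod \<tau>, \<theta> t \<omega>, \<lambda>\<eta>. \<Phi> t (\<theta> (-t) \<eta>) (\<xi> (\<theta> (-t) \<eta>))))"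

lemma hat_point_hat_Theta_map:
  assumes "metric_flow M \<theta>" "\<omega> \<in> space M"
  shows "hat_point (hat_Theta_map \<tau> \<theta> \<Phi> t (s, \<omega>, \<xi>)) = hat_Theta \<tau> \<theta> \<Phi> t (hat_point (s, \<omega>, \<xi>))"
proof -
  have "\<theta> (-t) (\<theta> t \<omega>) = \<theta> (-t + t) \<omega>" "\<theta> 0 \<omega> = \<omega>"
    using assms unfolding metric_flow_def by metis+
  then show ?thesis
    by (simp add: hat_point_def hat_Theta_map_def hat_Theta_def)
qed

definition hat_Y ::
    "(real \<Rightarrow> 'w \<Rightarrow> 'w) \<Rightarrow> (real \<Rightarrow> 'w \<Rightarrow> 'x \<Rightarrow> 'x) \<Rightarrow> real \<Rightarrow> real \<times> 'w \<times> ('w \<Rightarrow> 'x) \<Rightarrow> 'x" where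
  "hat_Y \<theta> \<Phi> t = (\<lambda>(s, \<omega>, \<xi>). \<Phi> (t + s) (\<theta> (-s) \<omega>) (\<xi> (\<theta> (-s) \<omega>)))"

end

theory Submission
  imports Defs
begin

text \<open>
  Since \<open>\<mu>\<^sub>s\<close> is the push-forward of \<open>\<mu>\<^sub>0\<close> under the skew product for \<open>s \<ge> 0\<close>, the measure \<open>\<mu>\<^sub>s(A)\<close> is
  Borel in \<open>s\<close>, and the set function defining \<open>hat_mu\<close> is the law of \<open>(0, skew_product \<theta> \<Phi> s p)\<close> for
  independent \<open>s\<close> uniform on \<open>[0, \<tau>)\<close> and \<open>p\<close> distributed as \<open>\<mu>\<^sub>0\<close>; the first coordinate is
  immaterial for the trivial \<open>\<sigma>\<close>-algebra. Invariance under \<open>hat_Theta \<tau> \<theta> \<Phi> t\<close> is the invariance of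
  the mean over a period under shifts. The claims on \<open>hat_Y\<close> are the cocycle property at
  \<open>\<theta> (-s) \<omega>\<close>.
\<close>

section \<open>Periodic functions on the line and their integrals over one period\<close>

lemma borel_measurable_rmod [measurable]: "(\<lambda>x. x rmod c) \<in> borel_measurable borel"
  unfolding rmod_def by measurable

lemma periodic_of_int:
  fixes f :: "real \<Rightarrow> 'a"
  assumes "\<And>s. f (c + s) = f s"
  shows "f (s + of_int n * c) = f s"
proof (induction n rule: int_induct[where k = 0])
  case (step1 i)
  then show ?case
    using assms[of "s + of_int i * c"] by (simp add: algebra_simps)
next
  case (step2 i)
  \<comment> \<open>Downwards, periodicity is read backwards, at the lower of the two
    points.\<close>
  then show ?case
    using assms[of "s + of_int (i - 1) * c"] by (simp add: algebra_simps)
qed simp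

text \<open>For positive \<open>c\<close>, \<open>s\<close> and \<open>s rmod c\<close> differ by
  the integer multiple \<open>\<lfloor>s / c\<rfloor> * c\<close>. The codomain is arbitrary so that
  the family \<open>\<mu>\<close> of measures itself can be taken for \<open>f\<close>.\<close>

lemma periodic_rmod:
  fixes f :: "real \<Rightarrow> 'a"
  assumes "\<And>s. f (c + s) = f s" "c > 0"
  shows "f (s rmod c) = f s"
  using periodic_of_int[of f c "s rmod c" "\<lfloor>s / c\<rfloor>", OF assms(1)] assms(2)
  by (simp add: rmod_def algebra_simps)

lemma nn_integral_shift_Ico:
  fixes f :: "real \<Rightarrow> ennreal"
  assumes "f \<in> borel_measurable borel"
  shows "(\<integral>\<^sup>+ s\<in>{a..<b}. f (s + t) \<partial>lborel) = (\<integral>\<^sup>+ s\<in>{a + t..<b + t}. f s \<partial>lborel)"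
proof -
  have "(\<integral>\<^sup>+ s\<in>{a + t..<b + t}. f s \<partial>lborel) =
      ennreal \<bar>1\<bar> * (\<integral>\<^sup>+ s. f (t + 1 * s) * indicator {a + t..<b + t} (t + 1 * s) \<partial>lborel)"
    using assms by (intro nn_integral_real_affine) auto
  also have "\<dots> = (\<integral>\<^sup>+ s\<in>{a..<b}. f (s + t) \<partial>lborel)"
    by (simp, intro nn_integral_cong) (auto simp: add.commute split: split_indicator)
  finally show ?thesis ..
qed

text \<open>By periodicity \<open>t\<close> may be replaced by its residue \<open>u\<close> in
  \<open>{0..<c}\<close>. The window \<open>{u..<c + u}\<close> is then cut at \<open>c\<close>, and
  the overhang \<open>{c..<c + u}\<close> is moved back by one period to \<open>{0..<u}\<close>,
  which completes \<open>{u..<c}\<close> to a full period.\<close>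

lemma nn_integral_periodic_shift:
  fixes f :: "real \<Rightarrow> ennreal"
  assumes f [measurable]: "f \<in> borel_measurable borel"
    and per: "\<And>s. f (c + s) = f s" and c: "c > 0"
  shows "(\<integral>\<^sup>+ s\<in>{0..<c}. f (s + t) \<partial>lborel) = (\<integral>\<^sup>+ s\<in>{0..<c}. f s \<partial>lborel)"
proof -
  define u where "u = t rmod c"
  have u: "0 \<le> u" "u < c"
    using c by (auto simp: u_def rmod_less rmod_nonneg)
  have fu: "f (s + t) = f (s + u)" for s
    using periodic_rmod[of "\<lambda>t. f (s + t)" c t] per[of "s + _"] c
    by (simp add: u_def algebra_simps)
  have split: "(\<integral>\<^sup>+ s\<in>{a..<b}. f s \<partial>lborel) + (\<integral>\<^sup>+ s\<in>{b..<d}. f s \<partial>lborel) =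
      (\<integral>\<^sup>+ s\<in>{a..<d}. f s \<partial>lborel)" if "a \<le> b" "b \<le> d" for a b d
    using that by (subst nn_integral_add[symmetric])
      (auto intro!: nn_integral_cong split: split_indicator)
  have "(\<integral>\<^sup>+ s\<in>{0..<c}. f (s + t) \<partial>lborel) = (\<integral>\<^sup>+ s\<in>{u..<c + u}. f s \<partial>lborel)"
    using nn_integral_shift_Ico[OF f, where a = 0 and b = c and t = u] by (simp add: fu)
  also have "\<dots> = (\<integral>\<^sup>+ s\<in>{u..<c}. f s \<partial>lborel) + (\<integral>\<^sup>+ s\<in>{c..<c + u}. f s \<partial>lborel)"
    using u by (subst split) auto
  also have "(\<integral>\<^sup>+ s\<in>{c..<c + u}. f s \<partial>lborel) = (\<integral>\<^sup>+ s\<in>{0..<u}. f s \<partial>lborel)"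
    using nn_integral_shift_Ico[OF f, where a = 0 and b = u and t = c] per by (simp add: add.commute)
  also have "(\<integral>\<^sup>+ s\<in>{u..<c}. f s \<partial>lborel) + (\<integral>\<^sup>+ s\<in>{0..<u}. f s \<partial>lborel) =
      (\<integral>\<^sup>+ s\<in>{0..<c}. f s \<partial>lborel)"
    using u by (subst add.commute, subst split) auto
  finally show ?thesis .
qed

section \<open>Products with the trivial \<sigma>-algebra\<close>

lemma space_hat_space: "space (hat_space M \<tau>) = {0..<\<tau>} \<times> space M \<times> UNIV"
  by (simp add: hat_space_def space_pair_measure)

lemma measurable_to_trivial:
  assumes "f \<in> space N \<rightarrow> S"
  shows "f \<in> N \<rightarrow>\<^sub>M sigma S {{}, S}"
proof (rule measurable_measure_of)
  have "f -` S \<inter> space N = space N"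
    using assms by auto
  then show "f -` y \<inter> space N \<in> sets N" if "y \<in> {{}, S}" for y
    using that by auto
qed (use assms in auto)

text \<open>Rectangles with full side \<open>S\<close> already form a \<sigma>-algebra, since
  complements and countable unions act on the second factor alone; a generator with empty first side
  is \<open>S \<times> {}\<close>.\<close>

lemma sets_trivial_pair:
  "B \<in> sets (sigma S {{}, S} \<Otimes>\<^sub>M N) \<longleftrightarrow> (\<exists>A\<in>sets N. B = S \<times> A)"
proof
  have trivial: "sets (sigma S {{}, S}) = {{}, S}"
    using sigma_algebra.sigma_sets_eq[OF sigma_algebra_trivial] by (simp add: sets_measure_of)
  assume "B \<in> sets (sigma S {{}, S} \<Otimes>\<^sub>M N)"
  then have "B \<in> sigma_sets (S \<times> space N) {a \<times> b |a b. a \<in> {{}, S} \<and> b \<in> sets N}"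
    by (simp add: sets_pair_measure trivial)
  then show "\<exists>A\<in>sets N. B = S \<times> A"
  proof induction
    case (Compl B)
    then obtain A where "A \<in> sets N" "B = S \<times> A" by blast
    then show ?case
      by (intro bexI[of _ "space N - A"]) auto
  next
    case (Union B)
    then obtain A where "\<And>i. A i \<in> sets N \<and> B i = S \<times> A i" by metis
    then show ?case
      by (intro bexI[of _ "\<Union>i. A i"]) auto
  qed (force intro: sets.empty_sets)+
next
  assume "\<exists>A\<in>sets N. B = S \<times> A"
  then show "B \<in> sets (sigma S {{}, S} \<Otimes>\<^sub>M N)"
    by auto
qed

lemma sets_hat_space:
  "B \<in> sets (hat_space M \<tau>) \<longleftrightarrow> (\<exists>A\<in>sets (M \<Otimes>\<^sub>M borel). B = {0..<\<tau>} \<times> A)"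
  by (simp only: hat_space_def sets_trivial_pair)

lemma measurable_snd_hat_space [measurable]: "snd \<in> hat_space M \<tau> \<rightarrow>\<^sub>M M \<Otimes>\<^sub>M borel"
  by (simp add: hat_space_def)

text \<open>Every map into a space with the trivial \<sigma>-algebra is measurable, so the circle
  coordinate contributes a range condition only.\<close>

lemma measurable_to_hat_space:
  assumes "\<And>x. x \<in> space N \<Longrightarrow> fst (f x) \<in> {0..<\<tau>}" "(\<lambda>x. snd (f x)) \<in> N \<rightarrow>\<^sub>M M \<Otimes>\<^sub>M borel"
  shows "f \<in> N \<rightarrow>\<^sub>M hat_space M \<tau>"
  unfolding hat_space_def measurable_pair_iff comp_def
  using assms by (auto intro: measurable_to_trivial)

section \<open>The flow, the cocycle and the periodic measure\<close>

locale periodic_rds =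
  fixes M :: "'w measure"
    and \<theta> :: "real \<Rightarrow> 'w \<Rightarrow> 'w"
    and \<Phi> :: "real \<Rightarrow> 'w \<Rightarrow> 'x::polish_space \<Rightarrow> 'x"
    and \<mu> :: "real \<Rightarrow> ('w \<times> 'x) measure"
    and \<tau> :: real
  assumes flow: "metric_flow M \<theta>"
    and rds: "random_dynamical_system M \<theta> \<Phi>"
    and tau_pos: "\<tau> > 0"
    and periodic: "periodic_probability_measure M \<theta> \<Phi> \<tau> \<mu>"
begin

lemma theta_closed: "\<omega> \<in> space M \<Longrightarrow> \<theta> t \<omega> \<in> space M"
  using flow measurable_space[of "\<lambda>(t, \<omega>). \<theta> t \<omega>" "borel \<Otimes>\<^sub>M M" M "(t, \<omega>)"]
  by (simp add: metric_flow_def space_pair_measure)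

lemma theta_0: "\<omega> \<in> space M \<Longrightarrow> \<theta> 0 \<omega> = \<omega>"
  and theta_add: "\<omega> \<in> space M \<Longrightarrow> \<theta> (s + t) \<omega> = \<theta> s (\<theta> t \<omega>)"
  using flow by (auto simp: metric_flow_def)

lemma measurable_theta: "\<theta> t \<in> M \<rightarrow>\<^sub>M M"
proof -
  have "(\<lambda>\<omega>. (\<lambda>(t, \<omega>). \<theta> t \<omega>) (t, \<omega>)) \<in> M \<rightarrow>\<^sub>M M"
    by (rule measurable_compose[OF measurable_Pair1'])
      (use flow in \<open>auto simp: metric_flow_def\<close>)
  then show ?thesis by simp
qed

lemma distr_theta: "distr M M (\<theta> t) = M"
  using flow by (simp add: metric_flow_def)

lemma AE_cocycle_at: "AE \<omega> in M. cocycle_at \<theta> \<Phi> \<omega>"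
  using rds by (simp add: random_dynamical_system_def)

text \<open>A measure-preserving map pulls null sets back to null sets. This serves
  \<open>hat_Y\<close>, which starts the cocycle at \<open>\<theta> (-s) \<omega>\<close> instead of
  \<open>\<omega>\<close>.\<close>

lemma AE_cocycle_at_theta: "AE \<omega> in M. cocycle_at \<theta> \<Phi> (\<theta> t \<omega>)"
  by (rule AE_distrD[OF measurable_theta]) (simp only: distr_theta AE_cocycle_at)

lemma prob_space_mu: "prob_space (\<mu> s)"
  and sets_mu [measurable_cong]: "sets (\<mu> s) = sets (M \<Otimes>\<^sub>M borel)"
  and marginal_mu: "distr (\<mu> s) M fst = M"
  and mu_periodic: "\<mu> (\<tau> + s) = \<mu> s"
  and distr_skew_product:
    "t \<ge> 0 \<Longrightarrow> distr (\<mu> s) (M \<Otimes>\<^sub>M borel) (skew_product \<theta> \<Phi> t) = \<mu> (t + s)"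
  using periodic by (simp_all add: periodic_probability_measure_def)

section \<open>Measurability of the skew product and of \<open>\<mu> s\<close> in
  \<open>s\<close>\<close>

lemma measurable_skew_product_pair:
  "(\<lambda>(t, p). skew_product \<theta> \<Phi> t p) \<in>
    restrict_space borel {0..} \<Otimes>\<^sub>M (M \<Otimes>\<^sub>M borel) \<rightarrow>\<^sub>M M \<Otimes>\<^sub>M borel"
proof -
  \<comment> \<open>\<open>\<theta>\<close> is measurable over the whole time line,
    \<open>\<Phi>\<close> over the half-line; the inclusion of the half-line lets both be evaluated
    on the same product space.\<close>
  have id: "(\<lambda>t. t) \<in> restrict_space borel {0..} \<rightarrow>\<^sub>M (borel :: real measure)"
    by (rule measurable_restrict_space1) simp
  have [measurable]: "(\<lambda>(t, \<omega>). \<theta> t \<omega>) \<in> borel \<Otimes>\<^sub>M M \<rightarrow>\<^sub>M M"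
    "(\<lambda>(t, \<omega>, x). \<Phi> t \<omega> x) \<in> restrict_space borel {0..} \<Otimes>\<^sub>M (M \<Otimes>\<^sub>M borel) \<rightarrow>\<^sub>M borel"
    using flow rds by (auto simp: metric_flow_def random_dynamical_system_def)
  have [measurable]: "fst \<in> restrict_space borel {0..} \<Otimes>\<^sub>M (M \<Otimes>\<^sub>M borel) \<rightarrow>\<^sub>M (borel :: real measure)"
    by (rule measurable_compose[OF measurable_fst id])
  have "(\<lambda>q. ((\<lambda>(t, \<omega>). \<theta> t \<omega>) (fst q, fst (snd q)), (\<lambda>(t, \<omega>, x). \<Phi> t \<omega> x) q)) \<in>
      restrict_space borel {0..} \<Otimes>\<^sub>M (M \<Otimes>\<^sub>M borel) \<rightarrow>\<^sub>M M \<Otimes>\<^sub>M borel"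
    by measurable
  then show ?thesis
    by (simp add: skew_product_def case_prod_unfold)
qed

lemma measurable_skew_product:
  assumes "t \<ge> 0"
  shows "skew_product \<theta> \<Phi> t \<in> M \<Otimes>\<^sub>M borel \<rightarrow>\<^sub>M M \<Otimes>\<^sub>M borel"
  using measurable_compose[OF measurable_Pair1'[of t "restrict_space borel {0..}" "M \<Otimes>\<^sub>M borel"]
      measurable_skew_product_pair] assms
  by (simp add: space_restrict_space)

lemma emeasure_mu_shift:
  assumes "t \<ge> 0" "A \<in> sets (M \<Otimes>\<^sub>M borel)"
  shows "emeasure (\<mu> (t + s)) A = emeasure (\<mu> s) (skew_product \<theta> \<Phi> t -` A \<inter> space (M \<Otimes>\<^sub>M borel))"
  using assms measurable_skew_product[OF assms(1)] sets_eq_imp_space_eq[OF sets_mu]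
  by (subst distr_skew_product[symmetric], simp, subst emeasure_distr)
    (auto cong: measurable_cong_sets simp: sets_mu)

lemma space_mu: "space (\<mu> s) = space M \<times> UNIV"
  using sets_eq_imp_space_eq[OF sets_mu, of s] by (simp add: space_pair_measure)

text \<open>For \<open>s \<ge> 0\<close> the value is the \<open>\<mu> 0\<close>-measure of the
  section at \<open>s\<close> of one jointly measurable set, and measures of sections are measurable
  in \<open>s\<close>.\<close>

lemma borel_measurable_mu:
  assumes A: "A \<in> sets (M \<Otimes>\<^sub>M borel)"
  shows "(\<lambda>s. emeasure (\<mu> s) A) \<in> borel_measurable borel"
proof -
  interpret mu0: prob_space "\<mu> 0" by (rule prob_space_mu)
  let ?R = "restrict_space borel {0..} :: real measure"
  let ?X = "(\<lambda>(t, p). skew_product \<theta> \<Phi> t p) -` A \<inter> space (?R \<Otimes>\<^sub>M (M \<Otimes>\<^sub>M borel))"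
  have "?X \<in> sets (?R \<Otimes>\<^sub>M \<mu> 0)"
    using measurable_sets[OF measurable_skew_product_pair A]
    by (simp cong: sets_pair_measure_cong add: sets_mu)
  then have "(\<lambda>s. emeasure (\<mu> 0) (Pair s -` ?X)) \<in> borel_measurable ?R"
    by (rule mu0.measurable_emeasure_Pair)
  also have "?this \<longleftrightarrow> (\<lambda>s. emeasure (\<mu> s) A) \<in> borel_measurable ?R"
  proof (rule measurable_cong)
    fix s assume s: "s \<in> space ?R"
    then have "Pair s -` ?X = skew_product \<theta> \<Phi> s -` A \<inter> space (M \<Otimes>\<^sub>M borel)"
      by (auto simp: space_pair_measure)
    with s emeasure_mu_shift[OF _ A, of s 0]
    show "emeasure (\<mu> 0) (Pair s -` ?X) = emeasure (\<mu> s) A"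
      by (simp add: space_restrict_space)
  qed
  \<comment> \<open>So far this covers the half-line only. Composition with \<open>rmod\<close>,
    which maps all of the line into \<open>{0..<\<tau>}\<close>, reaches negative times through
    periodicity.\<close>
  finally have "(\<lambda>s. emeasure (\<mu> (s rmod \<tau>)) A) \<in> borel_measurable borel"
    by (rule measurable_compose[rotated])
      (use tau_pos in \<open>auto intro!: measurable_restrict_space2 simp: rmod_nonneg\<close>)
  then show ?thesis
    using periodic_rmod[of \<mu> \<tau>] mu_periodic tau_pos by simp
qed

section \<open>The averaged measure as the law of a random point\<close>

definition uniform_tau :: "real measure" where
  "uniform_tau = uniform_measure (restrict_space lborel {0..}) {0..<\<tau>}"

text \<open>A \<open>distr\<close> is a measure by construction, so identifying
  \<open>hat_mu\<close> with it replaces a direct proof of countable additivity. The random time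
  lives on the half-line, where joint measurability of the skew product is given.\<close>

definition hat_law :: "(real \<times> 'w \<times> 'x) measure" where
  "hat_law = distr (uniform_tau \<Otimes>\<^sub>M \<mu> 0) (hat_space M \<tau>) (\<lambda>(s, p). (0, skew_product \<theta> \<Phi> s p))"

lemma sets_uniform_tau [measurable_cong]: "sets uniform_tau = sets (restrict_space borel {0..})"
  by (simp add: uniform_tau_def sets_restrict_space)

lemma Ico_in_sets: "{0..<\<tau>} \<in> sets (restrict_space lborel {0..})"
  by (auto simp: sets_restrict_space_iff)

lemma emeasure_Ico_tau: "emeasure (restrict_space lborel {0..}) {0..<\<tau>} = ennreal \<tau>"
  using tau_pos by (subst emeasure_restrict_space) auto

lemma prob_space_uniform_tau: "prob_space uniform_tau"
  unfolding uniform_tau_def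
  using tau_pos by (intro prob_space_uniform_measure) (simp_all add: emeasure_Ico_tau)

lemma nn_integral_uniform_tau:
  assumes "f \<in> borel_measurable borel"
  shows "(\<integral>\<^sup>+ s. f s \<partial>uniform_tau) = (\<integral>\<^sup>+ s\<in>{0..<\<tau>}. f s \<partial>lborel) / ennreal \<tau>"
proof -
  have "(\<integral>\<^sup>+ s. f s \<partial>uniform_tau) =
      (\<integral>\<^sup>+ s. f s * indicator {0..<\<tau>} s \<partial>restrict_space lborel {0..}) / ennreal \<tau>"
    using assms Ico_in_sets unfolding uniform_tau_def
    by (subst nn_integral_uniform_measure) (auto simp: emeasure_Ico_tau intro!: measurable_restrict_space1)
  also have "(\<integral>\<^sup>+ s. f s * indicator {0..<\<tau>} s \<partial>restrict_space lborel {0..}) =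
      (\<integral>\<^sup>+ s\<in>{0..<\<tau>}. f s \<partial>lborel)"
    by (subst nn_integral_restrict_space) (auto intro!: nn_integral_cong split: split_indicator)
  finally show ?thesis .
qed

lemma measurable_hat_law:
  "(\<lambda>(s, p). (0, skew_product \<theta> \<Phi> s p)) \<in> uniform_tau \<Otimes>\<^sub>M \<mu> 0 \<rightarrow>\<^sub>M hat_space M \<tau>"
proof (rule measurable_to_hat_space)
  have "(\<lambda>(s, p). skew_product \<theta> \<Phi> s p) \<in> uniform_tau \<Otimes>\<^sub>M \<mu> 0 \<rightarrow>\<^sub>M M \<Otimes>\<^sub>M borel"
    using measurable_skew_product_pair
    by (simp cong: measurable_cong_sets sets_pair_measure_cong add: sets_uniform_tau sets_mu)
  then show "(\<lambda>q. snd (case q of (s, p) \<Rightarrow> (0 :: real, skew_product \<theta> \<Phi> s p)))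
      \<in> uniform_tau \<Otimes>\<^sub>M \<mu> 0 \<rightarrow>\<^sub>M M \<Otimes>\<^sub>M borel"
    by (simp add: case_prod_unfold)
qed (use tau_pos in auto)

lemma emeasure_hat_law:
  assumes A: "A \<in> sets (M \<Otimes>\<^sub>M borel)"
  shows "emeasure hat_law ({0..<\<tau>} \<times> A) =
    (\<integral>\<^sup>+ s\<in>{0..<\<tau>}. emeasure (\<mu> s) A \<partial>lborel) / ennreal \<tau>"
proof -
  interpret mu0: prob_space "\<mu> 0" by (rule prob_space_mu)
  let ?N = "uniform_tau \<Otimes>\<^sub>M \<mu> 0"
  let ?X = "(\<lambda>(s, p). (0, skew_product \<theta> \<Phi> s p)) -` ({0..<\<tau>} \<times> A) \<inter> space ?N"
  have B: "{0..<\<tau>} \<times> A \<in> sets (hat_space M \<tau>)"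
    using A by (auto simp: sets_hat_space)
  have "emeasure hat_law ({0..<\<tau>} \<times> A) = emeasure ?N ?X"
    using B measurable_hat_law unfolding hat_law_def by (subst emeasure_distr) auto
  also have "\<dots> = (\<integral>\<^sup>+ s. emeasure (\<mu> 0) (Pair s -` ?X) \<partial>uniform_tau)"
    by (rule mu0.emeasure_pair_measure_alt) (rule measurable_sets[OF measurable_hat_law B])
  also have "\<dots> = (\<integral>\<^sup>+ s. emeasure (\<mu> s) A \<partial>uniform_tau)"
  proof (rule nn_integral_cong)
    fix s assume s: "s \<in> space uniform_tau"
    \<comment> \<open>The constant first coordinate \<open>0\<close> lies in
      \<open>{0..<\<tau>}\<close> because \<open>\<tau> > 0\<close>, which leaves only the condition
      on the second component.\<close>
    then have "Pair s -` ?X = skew_product \<theta> \<Phi> s -` A \<inter> space (M \<Otimes>\<^sub>M borel)"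
      using tau_pos by (auto simp: space_pair_measure space_mu)
    moreover have "s \<ge> 0"
      using s by (simp add: uniform_tau_def space_restrict_space)
    ultimately show "emeasure (\<mu> 0) (Pair s -` ?X) = emeasure (\<mu> s) A"
      using emeasure_mu_shift[OF _ A, of s 0] by simp
  qed
  finally show ?thesis
    by (simp add: nn_integral_uniform_tau borel_measurable_mu[OF A])
qed

text \<open>\<open>measure_of\<close> depends on the set function only through its values on the
  \<sigma>-algebra, and there they are those of a genuine measure. Hence the default null measure of
  \<open>measure_of\<close> does not intervene.\<close>

lemma hat_mu_eq_hat_law: "hat_mu M \<tau> \<mu> = hat_law"
proof -
  have "hat_mu M \<tau> \<mu> = measure_of (space (hat_space M \<tau>)) (sets (hat_space M \<tau>)) (emeasure hat_law)"
    unfolding hat_mu_def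
  proof (rule measure_of_eq[OF sets.space_closed])
    fix B :: "(real \<times> 'w \<times> 'x) set"
    assume "B \<in> sigma_sets (space (hat_space M \<tau>)) (sets (hat_space M \<tau>))"
    then obtain A where A: "A \<in> sets (M \<Otimes>\<^sub>M borel)" "B = {0..<\<tau>} \<times> A"
      by (auto simp: sets.sigma_sets_eq sets_hat_space)
    \<comment> \<open>The projection recovers \<open>A\<close> because the circle factor is
      nonempty.\<close>
    then have "snd ` B = A"
      using tau_pos by (simp add: snd_image_times)
    with A show "(\<integral>\<^sup>+ s\<in>{0..<\<tau>}. emeasure (\<mu> s) (snd ` B) \<partial>lborel) / ennreal \<tau> = emeasure hat_law B"
      by (simp add: emeasure_hat_law)
  qed
  also have "\<dots> = hat_law"
    using measure_of_of_measure[of hat_law] by (simp add: hat_law_def)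
  finally show ?thesis .
qed

lemma sets_hat_mu [measurable_cong]: "sets (hat_mu M \<tau> \<mu>) = sets (hat_space M \<tau>)"
  by (simp add: hat_mu_eq_hat_law hat_law_def)

lemma space_hat_mu: "space (hat_mu M \<tau> \<mu>) = {0..<\<tau>} \<times> space M \<times> UNIV"
  using sets_eq_imp_space_eq[OF sets_hat_mu] by (simp add: space_hat_space)

lemmas emeasure_hat_mu = emeasure_hat_law[folded hat_mu_eq_hat_law]

lemma prob_space_hat_mu: "prob_space (hat_mu M \<tau> \<mu>)"
proof -
  interpret U: prob_space uniform_tau by (rule prob_space_uniform_tau)
  interpret mu0: prob_space "\<mu> 0" by (rule prob_space_mu)
  interpret pair_prob_space uniform_tau "\<mu> 0" ..
  show ?thesis
    unfolding hat_mu_eq_hat_law hat_law_def by (rule prob_space_distr[OF measurable_hat_law])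
qed

section \<open>Dynamics on the extended space\<close>

lemma measurable_hat_Theta_pair:
  "(\<lambda>(t, q). hat_Theta \<tau> \<theta> \<Phi> t q) \<in>
    restrict_space borel {0..} \<Otimes>\<^sub>M hat_mu M \<tau> \<mu> \<rightarrow>\<^sub>M hat_mu M \<tau> \<mu>"
proof -
  have "(\<lambda>x. (\<lambda>(t, p). skew_product \<theta> \<Phi> t p) (fst x, snd (snd x))) \<in>
      restrict_space borel {0..} \<Otimes>\<^sub>M hat_space M \<tau> \<rightarrow>\<^sub>M M \<Otimes>\<^sub>M borel"
    by (rule measurable_compose[OF _ measurable_skew_product_pair]) measurable
  then have "(\<lambda>(t, q). hat_Theta \<tau> \<theta> \<Phi> t q) \<in>
      restrict_space borel {0..} \<Otimes>\<^sub>M hat_space M \<tau> \<rightarrow>\<^sub>M hat_space M \<tau>"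
    using tau_pos
    by (intro measurable_to_hat_space)
      (auto simp: hat_Theta_def skew_product_def case_prod_unfold rmod_nonneg rmod_less)
  then show ?thesis
    by (simp cong: measurable_cong_sets sets_pair_measure_cong add: sets_hat_mu)
qed

lemma measurable_hat_Theta:
  assumes "t \<ge> 0"
  shows "hat_Theta \<tau> \<theta> \<Phi> t \<in> hat_mu M \<tau> \<mu> \<rightarrow>\<^sub>M hat_mu M \<tau> \<mu>"
  using measurable_compose[OF measurable_Pair1'[of t "restrict_space borel {0..}" "hat_mu M \<tau> \<mu>"]
      measurable_hat_Theta_pair] assms
  by (simp add: space_restrict_space)

lemma distr_hat_Theta:
  assumes t: "t \<ge> 0"
  shows "distr (hat_mu M \<tau> \<mu>) (hat_mu M \<tau> \<mu>) (hat_Theta \<tau> \<theta> \<Phi> t) = hat_mu M \<tau> \<mu>"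
proof (rule measure_eqI)
  fix B assume "B \<in> sets (distr (hat_mu M \<tau> \<mu>) (hat_mu M \<tau> \<mu>) (hat_Theta \<tau> \<theta> \<Phi> t))"
  then obtain A where A: "A \<in> sets (M \<Otimes>\<^sub>M borel)" and B: "B = {0..<\<tau>} \<times> A"
    by (auto simp: sets_hat_mu sets_hat_space)
  let ?A = "skew_product \<theta> \<Phi> t -` A \<inter> space (M \<Otimes>\<^sub>M borel)"
  have A': "?A \<in> sets (M \<Otimes>\<^sub>M borel)"
    using measurable_skew_product[OF t] A by (rule measurable_sets)
  \<comment> \<open>\<open>rmod\<close> keeps the first coordinate in the circle, so membership in
    \<open>B\<close> constrains only the other two coordinates, which move by the skew
    product.\<close>
  have eq: "hat_Theta \<tau> \<theta> \<Phi> t -` B \<inter> space (hat_mu M \<tau> \<mu>) = {0..<\<tau>} \<times> ?A"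
    using tau_pos by (auto simp: B hat_Theta_def skew_product_def space_hat_mu space_pair_measure
        rmod_nonneg rmod_less)
  have "emeasure (distr (hat_mu M \<tau> \<mu>) (hat_mu M \<tau> \<mu>) (hat_Theta \<tau> \<theta> \<Phi> t)) B =
      emeasure (hat_mu M \<tau> \<mu>) ({0..<\<tau>} \<times> ?A)"
    using A by (subst emeasure_distr[OF measurable_hat_Theta[OF t]])
      (auto simp: eq sets_hat_mu sets_hat_space, auto simp: B)
  \<comment> \<open>Pulling \<open>A\<close> back by the skew product advances each
    \<open>\<mu> s\<close> by time \<open>t\<close>; the mean over a full period absorbs this
    shift.\<close>
  also have "\<dots> = (\<integral>\<^sup>+ s\<in>{0..<\<tau>}. emeasure (\<mu> (s + t)) A \<partial>lborel) / ennreal \<tau>"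
    using emeasure_mu_shift[OF t A] by (simp add: emeasure_hat_mu[OF A'] add.commute)
  also have "\<dots> = emeasure (hat_mu M \<tau> \<mu>) B"
    using tau_pos
    by (simp add: B emeasure_hat_mu[OF A] mu_periodic
        nn_integral_periodic_shift[of "\<lambda>s. emeasure (\<mu> s) A", OF borel_measurable_mu[OF A]])
  finally show "emeasure (distr (hat_mu M \<tau> \<mu>) (hat_mu M \<tau> \<mu>) (hat_Theta \<tau> \<theta> \<Phi> t)) B =
      emeasure (hat_mu M \<tau> \<mu>) B" .
qed simp

text \<open>On a cylinder over \<open>A\<close> the averaged integrand is the constant
  \<open>emeasure M A\<close>, as every \<open>\<mu> s\<close> has marginal \<open>M\<close>. This
  is what carries almost sure statements from \<open>M\<close> to \<open>hat_mu\<close>.\<close>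

lemma marginal_hat_mu: "distr (hat_mu M \<tau> \<mu>) M (\<lambda>q. fst (snd q)) = M"
proof (rule measure_eqI)
  fix A assume "A \<in> sets (distr (hat_mu M \<tau> \<mu>) M (\<lambda>q. fst (snd q)))"
  then have A [measurable]: "A \<in> sets M" by simp
  have "emeasure (\<mu> s) (A \<times> UNIV) = emeasure M A" for s
  proof -
    have "emeasure M A = emeasure (distr (\<mu> s) M fst) A"
      by (simp add: marginal_mu)
    also have "\<dots> = emeasure (\<mu> s) (fst -` A \<inter> space (\<mu> s))"
      by (rule emeasure_distr) measurable
    also have "fst -` A \<inter> space (\<mu> s) = A \<times> UNIV"
      using sets.sets_into_space[OF A] by (auto simp: space_mu)
    finally show ?thesis ..
  qed
  moreover have "(\<lambda>q. fst (snd q)) -` A \<inter> space (hat_mu M \<tau> \<mu>) = {0..<\<tau>} \<times> A \<times> UNIV"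
    using sets.sets_into_space[OF A] by (auto simp: space_hat_mu)
  moreover have "A \<times> UNIV \<in> sets (M \<Otimes>\<^sub>M borel)"
    by measurable
  ultimately show "emeasure (distr (hat_mu M \<tau> \<mu>) M (\<lambda>q. fst (snd q))) A = emeasure M A"
    using tau_pos
    by (subst emeasure_distr)
      (auto simp: emeasure_hat_mu nn_integral_cmult_indicator ennreal_mult_divide_eq)
qed simp

lemma AE_cocycle_at_hat: "AE q in hat_mu M \<tau> \<mu>. cocycle_at \<theta> \<Phi> (fst (snd q))"
proof (rule AE_distrD[where M' = M and f = "\<lambda>q. fst (snd q)"])
  show "(\<lambda>q. fst (snd q)) \<in> hat_mu M \<tau> \<mu> \<rightarrow>\<^sub>M M"
    by measurable
  show "AE \<omega> in distr (hat_mu M \<tau> \<mu>) M (\<lambda>q. fst (snd q)). cocycle_at \<theta> \<Phi> \<omega>"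
    by (simp only: marginal_hat_mu AE_cocycle_at)
qed

lemma hat_Theta_0:
  assumes "(s, \<omega>, x) \<in> space (hat_mu M \<tau> \<mu>)" "cocycle_at \<theta> \<Phi> \<omega>"
  shows "hat_Theta \<tau> \<theta> \<Phi> 0 (s, \<omega>, x) = (s, \<omega>, x)"
  using assms tau_pos by (simp add: hat_Theta_def space_hat_mu theta_0 cocycle_at_def)

lemma hat_Theta_add:
  assumes "(s, \<omega>, x) \<in> space (hat_mu M \<tau> \<mu>)" "cocycle_at \<theta> \<Phi> \<omega>" "t1 \<ge> 0" "t2 \<ge> 0"
  shows "hat_Theta \<tau> \<theta> \<Phi> (t1 + t2) (s, \<omega>, x) = hat_Theta \<tau> \<theta> \<Phi> t1 (hat_Theta \<tau> \<theta> \<Phi> t2 (s, \<omega>, x))"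
proof -
  \<comment> \<open>\<open>rmod_add\<close> combines two reduced summands, so the residue of
    \<open>s + t2\<close> is reduced a second time and \<open>t1\<close> along with it.\<close>
  have "((s + t2) rmod \<tau> + t1) rmod \<tau> = (((s + t2) rmod \<tau>) rmod \<tau> + t1 rmod \<tau>) rmod \<tau>"
    by (simp only: rmod_add)
  also have "\<dots> = (s + t2 + t1) rmod \<tau>"
    by (simp only: rmod_rmod rmod_add)
  finally have "((s + t2) rmod \<tau> + t1) rmod \<tau> = (s + (t1 + t2)) rmod \<tau>"
    by (simp add: algebra_simps)
  then show ?thesis
    using assms by (simp add: hat_Theta_def space_hat_mu theta_add cocycle_at_def)
qed

lemma random_dynamical_system_hat:
  "random_dynamical_system (hat_mu M \<tau> \<mu>) (hat_Theta \<tau> \<theta> \<Phi>) (hat_Phi \<Phi>)"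
  unfolding random_dynamical_system_def metric_semiflow_def
proof (intro conjI prob_space_hat_mu measurable_hat_Theta_pair allI impI distr_hat_Theta)
  \<comment> \<open>One null set serves all pairs of times, since \<open>cocycle_at\<close>
    quantifies over the times at a fixed base point.\<close>
  show "AE q in hat_mu M \<tau> \<mu>. hat_Theta \<tau> \<theta> \<Phi> 0 q = q \<and>
      (\<forall>s\<ge>0. \<forall>t\<ge>0. hat_Theta \<tau> \<theta> \<Phi> (s + t) q = hat_Theta \<tau> \<theta> \<Phi> s (hat_Theta \<tau> \<theta> \<Phi> t q))"
    using AE_cocycle_at_hat AE_space
  proof eventually_elim
    case (elim q)
    then show ?case
      by (cases q) (simp add: hat_Theta_0 hat_Theta_add)
  qed
  \<comment> \<open>\<open>hat_Phi\<close> reads only the second coordinate, on which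
    \<open>hat_Theta\<close> acts as \<open>\<theta>\<close>; the cocycle property at
    \<open>q\<close> is thus that of \<open>\<Phi>\<close> at \<open>fst (snd q)\<close>.\<close>
  show "AE q in hat_mu M \<tau> \<mu>. cocycle_at (hat_Theta \<tau> \<theta> \<Phi>) (hat_Phi \<Phi>) q"
    using AE_cocycle_at_hat
    by eventually_elim (auto simp: cocycle_at_def hat_Phi_def hat_Theta_def)
  have Phi: "(\<lambda>(t, \<omega>, x). \<Phi> t \<omega> x) \<in> restrict_space borel {0..} \<Otimes>\<^sub>M (M \<Otimes>\<^sub>M borel) \<rightarrow>\<^sub>M borel"
    using rds by (simp add: random_dynamical_system_def)
  have "(\<lambda>x. (\<lambda>(t, \<omega>, x). \<Phi> t \<omega> x) (fst x, fst (snd (fst (snd x))), snd (snd x))) \<in>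
      restrict_space borel {0..} \<Otimes>\<^sub>M (hat_mu M \<tau> \<mu> \<Otimes>\<^sub>M borel) \<rightarrow>\<^sub>M borel"
    by (rule measurable_compose[OF _ Phi]) measurable
  then show "(\<lambda>(t, q, x). hat_Phi \<Phi> t q x) \<in>
      restrict_space borel {0..} \<Otimes>\<^sub>M (hat_mu M \<tau> \<mu> \<Otimes>\<^sub>M borel) \<rightarrow>\<^sub>M borel"
    by (simp add: hat_Phi_def case_prod_unfold)
qed

section \<open>The random periodic path\<close>

lemma hat_Y_path:
  assumes "s \<ge> 0" "\<omega> \<in> space M" "cocycle_at \<theta> \<Phi> (\<theta> (-s) \<omega>)" "r \<ge> 0" "t \<ge> 0"
  shows "hat_Phi \<Phi> r (hat_Theta \<tau> \<theta> \<Phi> t (hat_point (s, \<omega>, \<xi>))) (hat_Y \<theta> \<Phi> t (s, \<omega>, \<xi>)) =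
    hat_Y \<theta> \<Phi> (r + t) (s, \<omega>, \<xi>)"
proof -
  \<comment> \<open>Seen from the base point \<open>\<theta> (-s) \<omega>\<close>, the current
    point is reached at time \<open>t + s\<close>, the time used by \<open>hat_Y\<close>; advancing
    by \<open>r\<close> is then a single cocycle step.\<close>
  have "\<theta> t \<omega> = \<theta> (t + s) (\<theta> (-s) \<omega>)"
    using assms(2) by (simp flip: theta_add)
  moreover have "\<Phi> (r + (t + s)) (\<theta> (-s) \<omega>) = \<Phi> r (\<theta> (t + s) (\<theta> (-s) \<omega>)) \<circ> \<Phi> (t + s) (\<theta> (-s) \<omega>)"
    using assms by (simp add: cocycle_at_def)
  ultimately show ?thesis
    by (simp add: hat_Phi_def hat_Theta_def hat_point_def hat_Y_def add.assoc)
qed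

lemma hat_Y_periodic:
  assumes "s \<in> {0..<\<tau>}" "\<omega> \<in> space M" "cocycle_at \<theta> \<Phi> (\<theta> (-s) \<omega>)" "t \<ge> 0"
  shows "hat_Y \<theta> \<Phi> (t + \<tau>) (s, \<omega>, \<xi>) = hat_Y \<theta> \<Phi> t (hat_Theta_map \<tau> \<theta> \<Phi> \<tau> (s, \<omega>, \<xi>))"
proof -
  \<comment> \<open>The witness \<open>1\<close> counts the full turn after which the circle
    coordinate is back at \<open>s\<close>.\<close>
  have mod: "(s + \<tau>) rmod \<tau> = s"
    using assms(1) tau_pos by (intro rmod_unique[of _ _ _ 1]) auto
  have shift: "\<theta> (-s) (\<theta> \<tau> \<omega>) = \<theta> \<tau> (\<theta> (-s) \<omega>)"
    using assms(2) by (simp add: add.commute flip: theta_add)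
  \<comment> \<open>The transported map pulls its argument back by
    \<open>\<theta> (-\<tau>)\<close>, so \<open>\<xi>\<close> is evaluated at the old base point
    and then moved by \<open>\<Phi> \<tau>\<close>. What remains is the cocycle property split at
    time \<open>\<tau>\<close>.\<close>
  have inv: "\<theta> (-\<tau>) (\<theta> \<tau> (\<theta> (-s) \<omega>)) = \<theta> (-s) \<omega>"
    using assms(2) by (simp add: theta_closed theta_0 flip: theta_add[of "\<theta> (-s) \<omega>"])
  have "\<Phi> (t + s + \<tau>) (\<theta> (-s) \<omega>) = \<Phi> (t + s) (\<theta> \<tau> (\<theta> (-s) \<omega>)) \<circ> \<Phi> \<tau> (\<theta> (-s) \<omega>)"
    using assms tau_pos by (simp add: cocycle_at_def)
  then show ?thesis
    by (simp add: hat_Y_def hat_Theta_map_def mod shift inv add.assoc add.commute[of \<tau>])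
qed

end

theorem theorem7p2:
  fixes M :: "'w measure"
    and \<theta> :: "real \<Rightarrow> 'w \<Rightarrow> 'w"
    and \<Phi> :: "real \<Rightarrow> 'w \<Rightarrow> 'x::polish_space \<Rightarrow> 'x"
    and \<mu> :: "real \<Rightarrow> ('w \<times> 'x) measure"
    and \<tau> :: real
  assumes "metric_flow M \<theta>"
    and "random_dynamical_system M \<theta> \<Phi>"
    and "\<tau> > 0"
    and "periodic_probability_measure M \<theta> \<Phi> \<tau> \<mu>"
  shows
    "sets (hat_mu M \<tau> \<mu>) = sets (hat_space M \<tau>) \<and>
     (\<forall>A\<in>sets (M \<Otimes>\<^sub>M borel).
        emeasure (hat_mu M \<tau> \<mu>) ({0..<\<tau>} \<times> A) =
          (\<integral>\<^sup>+ s\<in>{0..<\<tau>}. emeasure (\<mu> s) A \<partial>lborel) / ennreal \<tau> \<and>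
        emeasure (hat_mu M \<tau> \<mu>) ({} \<times> A) = 0) \<and>
     prob_space (hat_mu M \<tau> \<mu>) \<and>
     (\<forall>t\<ge>0. hat_Theta \<tau> \<theta> \<Phi> t \<in> hat_mu M \<tau> \<mu> \<rightarrow>\<^sub>M hat_mu M \<tau> \<mu> \<and>
        distr (hat_mu M \<tau> \<mu>) (hat_mu M \<tau> \<mu>) (hat_Theta \<tau> \<theta> \<Phi> t) = hat_mu M \<tau> \<mu>) \<and>
     (AE (s, \<omega>, x) in hat_mu M \<tau> \<mu>. cocycle_at \<theta> \<Phi> \<omega>) \<and>
     (\<forall>(s, \<omega>, x)\<in>space (hat_mu M \<tau> \<mu>). cocycle_at \<theta> \<Phi> \<omega> \<longrightarrow>
        (\<forall>t\<^sub>1\<ge>0. \<forall>t\<^sub>2\<ge>0. hat_Theta \<tau> \<theta> \<Phi> t\<^sub>1 (hat_Theta \<tau> \<theta> \<Phi> t\<^sub>2 (s, \<omega>, x)) =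
           hat_Theta \<tau> \<theta> \<Phi> (t\<^sub>1 + t\<^sub>2) (s, \<omega>, x))) \<and>
     random_dynamical_system (hat_mu M \<tau> \<mu>) (hat_Theta \<tau> \<theta> \<Phi>) (hat_Phi \<Phi>) \<and>
     (\<forall>s\<in>{0..<\<tau>}.
        (AE \<omega> in M. cocycle_at \<theta> \<Phi> (\<theta> (-s) \<omega>)) \<and>
        (\<forall>\<omega>\<in>space M. cocycle_at \<theta> \<Phi> (\<theta> (-s) \<omega>) \<longrightarrow>
           (\<forall>\<xi> :: 'w \<Rightarrow> 'x. \<forall>r\<ge>0. \<forall>t\<ge>0.
              hat_Phi \<Phi> r (hat_Theta \<tau> \<theta> \<Phi> t (hat_point (s, \<omega>, \<xi>))) (hat_Y \<theta> \<Phi> t (s, \<omega>, \<xi>)) =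
                hat_Y \<theta> \<Phi> (r + t) (s, \<omega>, \<xi>) \<and>
              hat_Y \<theta> \<Phi> (t + \<tau>) (s, \<omega>, \<xi>) =
                hat_Y \<theta> \<Phi> t (hat_Theta_map \<tau> \<theta> \<Phi> \<tau> (s, \<omega>, \<xi>)))))"

proof -
  interpret periodic_rds M \<theta> \<Phi> \<mu> \<tau>
    using assms by unfold_locales
  show ?thesis
    using AE_cocycle_at_hat
    by (auto simp: sets_hat_mu emeasure_hat_mu prob_space_hat_mu measurable_hat_Theta
        distr_hat_Theta hat_Theta_add random_dynamical_system_hat AE_cocycle_at_theta
        hat_Y_path hat_Y_periodic case_prod_unfold)
qed

end
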